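(* Let $a,b,c,k,l,m$ be positive integers with $c\mid ab$ and $k,l\ge m$, let $i\in\{1,2\}$, and let $d=d_i^{\pm}=a^{2k}b^{2l}\pm i c^m$ (for a fixed choice of sign) be a square-free positive integer. Let $F_{\Delta_d}(x,y)=x^2-dy^2$, and let $(x_1,y_1)$ be the fundamental solution of $F_{\Delta_d}(x,y)=1$. Then the $n$-th integer solution of $F_{\Delta_d}(x,y)=1$ is $(x_n,y_n)$, where $$x_n=\begin{cases}\displaystyle\sum_{j=0}^{n/2}\binom{n}{2j}x_1^{\,n-2j}y_1^{\,2j}d^{\,j}, & n\text{ even},\\[2mm] \displaystyle\sum_{j=0}^{(n-1)/2}\binom{n}{2j}x_1^{\,n-2j}y_1^{\,2j}d^{\,j}, & n\text{ odd},\end{cases}$$ $$y_n=\begin{cases}\displaystyle\sum_{j=0}^{(n-2)/2}\binom{n}{2j+1}x_1^{\,n-1-2j}y_1^{\,2j+1}d^{\,j}, & n\text{ even},\\[2mm] \displaystyle\sum_{j=0}^{(n-1)/2}\binom{n}{2j+1}x_1^{\,n-1-2j}y_1^{\,2j+1}d^{\,j}, & n\text{ odd}.\end{cases}$$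
   Context: The fundamental solution is the solution in positive integers with least positive values. The $n$-th integer solution ($n\ge1$) means the $n$-th solution in positive integers, listed in increasing order, the first being the fundamental solution. *)

theory Defs
  imports "HOL-Computational_Algebra.Squarefree"
begin

definition pell_form :: "int \<Rightarrow> int \<Rightarrow> int \<Rightarrow> int" where
  "pell_form d x y = x\<^sup>2 - d * y\<^sup>2"

definition pell_solutions :: "int \<Rightarrow> (int \<times> int) set" where
  "pell_solutions d = {(x, y). x > 0 \<and> y > 0 \<and> pell_form d x y = 1}"

definition is_fundamental_solution :: "int \<Rightarrow> int \<times> int \<Rightarrow> bool" where
  "is_fundamental_solution d p \<longleftrightarrow> p \<in> pell_solutions d \<and>
     (\<forall>q \<in> pell_solutions d. fst p \<le> fst q \<and> snd p \<le> snd q)"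

text \<open>The indices start at 1; the value \<open>s 0\<close> is irrelevant.\<close>

definition lists_pell_solutions :: "int \<Rightarrow> (nat \<Rightarrow> int \<times> int) \<Rightarrow> bool" where
  "lists_pell_solutions d s \<longleftrightarrow> s ` {1..} = pell_solutions d \<and>
     (\<forall>i j. 1 \<le> i \<and> i < j \<longrightarrow> fst (s i) < fst (s j) \<and> snd (s i) < snd (s j))"

definition is_nth_solution :: "int \<Rightarrow> nat \<Rightarrow> int \<times> int \<Rightarrow> bool" where
  "is_nth_solution d n p \<longleftrightarrow> n \<ge> 1 \<and> (\<exists>s. lists_pell_solutions d s \<and> s n = p)"

end

theory Submission
  imports Defs Complex_Main
begin

text \<open>
  Multiplication by the fundamental unit \<open>x\<^sub>1 + y\<^sub>1 \<surd>d\<close> maps positive solutions to strictly larger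
  positive solutions, and multiplication by its conjugate takes any positive solution other than
  the fundamental one to a strictly smaller positive solution. By descent every positive solution is a
  power of the fundamental unit, and the binomial theorem separates the rational and irrational
  parts of that power.
\<close>

text \<open>The pair of integer coefficients of \<open>(u + v * sqrt d) ^ n\<close> with respect to
  \<open>1\<close> and \<open>sqrt d\<close>.\<close>

fun pell_power :: "int \<Rightarrow> int \<times> int \<Rightarrow> nat \<Rightarrow> int \<times> int" where
  "pell_power d (u, v) 0 = (1, 0)"
| "pell_power d (u, v) (Suc n) =
     (let (x, y) = pell_power d (u, v) n in (u * x + d * v * y, u * y + v * x))"

lemma pell_solutions_iff:
  "(x, y) \<in> pell_solutions d \<longleftrightarrow> x > 0 \<and> y > 0 \<and> x\<^sup>2 = 1 + d * y\<^sup>2"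
  by (auto simp: pell_solutions_def pell_form_def)

text \<open>Brahmagupta's identity: the norm of \<open>x + y * sqrt d\<close> is multiplicative. No
  signs are assumed, so \<open>v\<close> may be replaced by \<open>- v\<close> to treat the
  conjugate.\<close>

lemma pell_norm_mult:
  fixes u v x y d :: int
  assumes "u\<^sup>2 = 1 + d * v\<^sup>2" and "x\<^sup>2 = 1 + d * y\<^sup>2"
  shows "(u * x + d * v * y)\<^sup>2 = 1 + d * (u * y + v * x)\<^sup>2"
proof -
  have "(u * x + d * v * y)\<^sup>2 - d * (u * y + v * x)\<^sup>2 = (u\<^sup>2 - d * v\<^sup>2) * (x\<^sup>2 - d * y\<^sup>2)"
    by (simp add: power2_eq_square algebra_simps)
  with assms show ?thesis by simp
qed

lemma pell_mult_increasing:
  fixes u v x y d :: int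
  assumes "d > 0" "u > 0" "v > 0" "x > 0" "y > 0"
  shows "x < u * x + d * v * y" and "y < u * y + v * x"
proof -
  have "1 * x \<le> u * x" "1 * y \<le> u * y"
    using assms by (intro mult_right_mono; simp)+
  moreover have "0 < d * v * y" "0 < v * x" using assms by simp_all
  ultimately show "x < u * x + d * v * y" and "y < u * y + v * x" by linarith+
qed

lemma pell_power_in_solutions:
  assumes "d > 0" and "(u, v) \<in> pell_solutions d"
  shows "pell_power d (u, v) (Suc n) \<in> pell_solutions d"
proof (induction n)
  case 0
  then show ?case using assms by simp
next
  case (Suc n)
  obtain x y where xy: "pell_power d (u, v) (Suc n) = (x, y)" by (cases "pell_power d (u, v) (Suc n)")
  have "pell_power d (u, v) (Suc (Suc n)) = (u * x + d * v * y, u * y + v * x)"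
    \<comment> \<open>Only the outermost step is unfolded, so that \<open>xy\<close> still matches
      the inner power.\<close>
    using xy by (simp only: pell_power.simps(2)[of d u v "Suc n"]) simp
  moreover have "(u * x + d * v * y, u * y + v * x) \<in> pell_solutions d"
    using Suc.IH assms unfolding xy pell_solutions_iff
    by (auto intro!: pell_norm_mult add_pos_pos mult_pos_pos)
  ultimately show ?case by (simp only:)
qed

lemma pell_power_strict_mono:
  assumes "d > 0" and "(u, v) \<in> pell_solutions d" and "1 \<le> i" and "i < j"
  shows "fst (pell_power d (u, v) i) < fst (pell_power d (u, v) j) \<and>
    snd (pell_power d (u, v) i) < snd (pell_power d (u, v) j)"
  using \<open>i < j\<close> \<open>1 \<le> i\<close>
proof (induction rule: less_Suc_induct)
  case (1 n)
  \<comment> \<open>Index 0 must be excluded here: its pair \<open>(1, 0)\<close> is not a positive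
    solution.\<close>
  then obtain n' where n': "n = Suc n'" by (cases n) auto
  obtain x y where xy: "pell_power d (u, v) n = (x, y)" by (cases "pell_power d (u, v) n")
  have "(x, y) \<in> pell_solutions d"
    using pell_power_in_solutions[OF assms(1,2), of n'] xy n' by simp
  then show ?case
    using pell_mult_increasing[of d u v x y] assms xy by (simp add: pell_solutions_iff)
qed auto

text \<open>The quotient by \<open>u + v * sqrt d\<close> is the product with the conjugate, hence
  again of norm 1. Positivity of both components is read off from differences of squares; only the
  second component uses \<open>v < y\<close>.\<close>

lemma pell_descent:
  fixes u v x y d :: int
  assumes "d > 0" and "(u, v) \<in> pell_solutions d" and "(x, y) \<in> pell_solutions d" and "v < y"
  shows "(u * x - d * v * y, u * y - v * x) \<in> pell_solutions d"
proof -
  have pos: "u > 0" "v > 0" "x > 0" "y > 0" and eq: "u\<^sup>2 = 1 + d * v\<^sup>2" "x\<^sup>2 = 1 + d * y\<^sup>2"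
    using assms by (auto simp: pell_solutions_iff)
  have "(d * v * y)\<^sup>2 < (u * x)\<^sup>2"
  proof -
    have "(u * x)\<^sup>2 - (d * v * y)\<^sup>2 = 1 + d * v\<^sup>2 + d * y\<^sup>2"
      unfolding power_mult_distrib eq by (simp add: power2_eq_square algebra_simps)
    moreover have "0 \<le> d * v\<^sup>2" "0 \<le> d * y\<^sup>2" using \<open>d > 0\<close> by simp_all
    ultimately show ?thesis by linarith
  qed
  then have 1: "d * v * y < u * x"
    by (rule power_less_imp_less_base) (use pos in simp)
  have "(v * x)\<^sup>2 < (u * y)\<^sup>2"
  proof -
    have "(u * y)\<^sup>2 - (v * x)\<^sup>2 = y\<^sup>2 - v\<^sup>2"
      unfolding power_mult_distrib eq by (simp add: algebra_simps)
    moreover have "v\<^sup>2 < y\<^sup>2" using \<open>v < y\<close> pos by (intro power_strict_mono) auto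
    ultimately show ?thesis by linarith
  qed
  then have 2: "v * x < u * y"
    by (rule power_less_imp_less_base) (use pos in simp)
  have "(u * x + d * (- v) * y)\<^sup>2 = 1 + d * (u * y + (- v) * x)\<^sup>2"
    using eq by (intro pell_norm_mult) auto
  with 1 2 show ?thesis by (simp add: pell_solutions_iff)
qed

lemma pell_solution_is_power:
  assumes "d > 0" and fund: "is_fundamental_solution d (u, v)" and "(x, y) \<in> pell_solutions d"
  shows "\<exists>n. (x, y) = pell_power d (u, v) (Suc n)"
  using assms(3)
proof (induction "nat y" arbitrary: x y rule: less_induct)
  case less
  have uv: "(u, v) \<in> pell_solutions d" and "v \<le> y"
    using fund less.prems by (auto simp: is_fundamental_solution_def)
  then consider "v = y" | "v < y" by linarith
  then show ?case
  proof cases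
    case 1
    \<comment> \<open>The second component determines a positive solution.\<close>
    then have "x\<^sup>2 = u\<^sup>2" "x > 0" "u > 0" using uv less.prems by (auto simp: pell_solutions_iff)
    then have "x = u" by (simp add: power2_eq_iff_nonneg)
    then have "(x, y) = pell_power d (u, v) (Suc 0)" using 1 by simp
    then show ?thesis by blast
  next
    case 2
    define x' y' where "x' = u * x - d * v * y" and "y' = u * y - v * x"
    have sol: "(x', y') \<in> pell_solutions d"
      unfolding x'_def y'_def using pell_descent[OF \<open>d > 0\<close> uv less.prems 2] .
    \<comment> \<open>Multiplying the quotient back by the unit restores \<open>(x, y)\<close>,
      because the unit has norm 1.\<close>
    have "u * x' + d * v * y' = (u\<^sup>2 - d * v\<^sup>2) * x" "u * y' + v * x' = (u\<^sup>2 - d * v\<^sup>2) * y"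
      by (simp_all add: x'_def y'_def power2_eq_square algebra_simps)
    then have inv: "x = u * x' + d * v * y'" "y = u * y' + v * x'"
      using uv by (simp_all add: pell_solutions_iff)
    \<comment> \<open>Since \<open>(x, y)\<close> is the product of \<open>(x', y')\<close> with the
      unit, the growth lemma shows that the descent decreases.\<close>
    have "y' < y" "0 < y'"
      using pell_mult_increasing(2)[of d u v x' y'] uv sol \<open>d > 0\<close> inv
      by (simp_all add: pell_solutions_iff)
    then have "nat y' < nat y" by simp
    then obtain n where "(x', y') = pell_power d (u, v) (Suc n)" using less.hyps sol by blast
    then have "(x, y) = pell_power d (u, v) (Suc (Suc n))"
      by (simp only: pell_power.simps(2)[of d u v "Suc n"] inv flip: \<open>(x', y') = _\<close>) simp
    then show ?thesis by blast
  qed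
qed

lemma lists_pell_solutions_power:
  assumes "d > 0" and "is_fundamental_solution d (u, v)"
  shows "lists_pell_solutions d (pell_power d (u, v))"
proof -
  have uv: "(u, v) \<in> pell_solutions d" using assms by (simp add: is_fundamental_solution_def)
  have "pell_power d (u, v) ` {1..} = pell_solutions d"
  proof (intro equalityI subsetI)
    fix p assume "p \<in> pell_power d (u, v) ` {1..}"
    then obtain n where "n \<ge> 1" "p = pell_power d (u, v) n" by auto
    then show "p \<in> pell_solutions d"
      using pell_power_in_solutions[OF \<open>d > 0\<close> uv, of "n - 1"] by simp
  next
    fix p assume "p \<in> pell_solutions d"
    then obtain n where "p = pell_power d (u, v) (Suc n)"
      using pell_solution_is_power[OF assms] by (cases p) blast
    then show "p \<in> pell_power d (u, v) ` {1..}" by (rule image_eqI) simp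
  qed
  then show ?thesis
    unfolding lists_pell_solutions_def using pell_power_strict_mono[OF \<open>d > 0\<close> uv] by blast
qed

text \<open>The binomial expansion is sorted by the parity of the exponent of \<open>w\<close>. The
  common bound \<open>n div 2\<close> avoids a case distinction on \<open>n\<close>: for even
  \<open>n\<close> the last term of the odd part has coefficient
  \<open>n choose (n + 1) = 0\<close>.\<close>

lemma binomial_parity_split:
  fixes u w :: "'a :: comm_semiring_1"
  shows "(u + w) ^ n =
    (\<Sum>j = 0..n div 2. of_nat (n choose (2 * j)) * u ^ (n - 2 * j) * w ^ (2 * j)) +
    (\<Sum>j = 0..n div 2. of_nat (n choose (2 * j + 1)) * u ^ (n - 1 - 2 * j) * w ^ (2 * j + 1))"
proof -
  define f where "f k = of_nat (n choose k) * u ^ (n - k) * w ^ k" for k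
  have split: "(\<Sum>k<2 * N. f k) = (\<Sum>j<N. f (2 * j)) + (\<Sum>j<N. f (2 * j + 1))" for N
    by (induction N) (simp_all add: algebra_simps)
  have "(u + w) ^ n = (w + u) ^ n" by (simp add: add.commute)
  also have "\<dots> = (\<Sum>k\<le>n. f k)"
    unfolding binomial_ring f_def by (simp add: mult_ac)
  \<comment> \<open>The range is padded to even length; this adds the vanishing index
    \<open>n + 1\<close> when \<open>n\<close> is even and nothing when \<open>n\<close> is
    odd.\<close>
  also have "\<dots> = (\<Sum>k<2 * Suc (n div 2). f k)"
    by (rule sum.mono_neutral_left) (auto simp: f_def binomial_eq_0)
  also have "\<dots> = (\<Sum>j = 0..n div 2. f (2 * j)) + (\<Sum>j = 0..n div 2. f (2 * j + 1))"
    unfolding split by (simp only: lessThan_Suc_atMost atLeast0AtMost)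
  finally show ?thesis by (simp add: f_def)
qed

text \<open>The recursion and the binomial theorem expand the same power
  \<open>(u + v * r) ^ n\<close>. Both expansions are proved for every real \<open>r\<close> with
  \<open>r * r = d\<close>, so that either sign of the root may be inserted.\<close>

lemma pell_power_eq_binomial_sums:
  assumes "d > 0"
  shows "pell_power d (u, v) n =
    (\<Sum>j = 0..n div 2. int (n choose (2 * j)) * u ^ (n - 2 * j) * v ^ (2 * j) * d ^ j,
     \<Sum>j = 0..n div 2. int (n choose (2 * j + 1)) * u ^ (n - 1 - 2 * j) * v ^ (2 * j + 1) * d ^ j)"
    (is "_ = (?X, ?Y)")
proof -
  obtain x y where xy: "pell_power d (u, v) n = (x, y)" by (cases "pell_power d (u, v) n")
  have unit_power: "(of_int u + of_int v * r) ^ n = of_int x + of_int y * r"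
    if r: "r * r = of_int d" for r :: real
    using xy
  proof (induction n arbitrary: x y)
    case (Suc n)
    obtain x' y' where xy': "pell_power d (u, v) n = (x', y')" by (cases "pell_power d (u, v) n")
    then have "x = u * x' + d * v * y'" "y = u * y' + v * x'" using Suc.prems by simp_all
    then show ?case
      using Suc.IH[OF xy'] by (simp add: algebra_simps flip: r)
  qed simp
  have binomial: "(of_int u + of_int v * r) ^ n = of_int ?X + of_int ?Y * r"
    if r: "r * r = of_int d" for r :: real
  proof -
    \<comment> \<open>Even powers of \<open>r\<close> become powers of \<open>d\<close>; odd ones
      leave a single factor \<open>r\<close>.\<close>
    have r_even: "r ^ (j * 2) = of_int d ^ j" for j
      by (simp add: power_mult power2_eq_square r mult.commute[of j])
    show ?thesis
      unfolding binomial_parity_split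
      by (simp add: sum_distrib_left power_mult_distrib r_even mult_ac)
  qed
  \<comment> \<open>Comparing both expansions at \<open>r\<close> and \<open>- r\<close> avoids any appeal to the irrationality of \<open>\<surd>d\<close>.\<close>
  define r where "r = sqrt (of_int d)"
  have r: "r * r = of_int d" "(- r) * (- r) = of_int d" "r > 0"
    using assms by (simp_all add: r_def)
  have "real_of_int x + of_int y * r = of_int ?X + of_int ?Y * r"
    using unit_power[OF r(1)] binomial[OF r(1)] by (simp only:)
  moreover have "real_of_int x + of_int y * (- r) = of_int ?X + of_int ?Y * (- r)"
    using unit_power[OF r(2)] binomial[OF r(2)] by (simp only:)
  \<comment> \<open>Sum and difference of the two equations separate the coefficients; the factor
    \<open>r\<close> is then cancelled.\<close>
  ultimately have "real_of_int x = of_int ?X" "real_of_int y * r = of_int ?Y * r" by linarith+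
  then have "x = ?X" "y = ?Y" using \<open>r > 0\<close> by (simp_all only: mult_right_cancel of_int_eq_iff)
  then show ?thesis using xy by simp
qed

theorem theorem5p2:
  fixes a b c i sgn_d d x\<^sub>1 y\<^sub>1 :: int and k l m n :: nat
  assumes "a > 0" "b > 0" "c > 0" "k > 0" "l > 0" "m > 0"
    and "c dvd a * b" and "k \<ge> m" and "l \<ge> m"
    and "i \<in> {1, 2}" and "sgn_d \<in> {1, -1}"
    and "d = a ^ (2 * k) * b ^ (2 * l) + sgn_d * i * c ^ m"
    and "d > 0" and "squarefree d"
    and "is_fundamental_solution d (x\<^sub>1, y\<^sub>1)"
    and "n \<ge> 1"
  shows "is_nth_solution d n
    (if even n
       then \<Sum>j = 0..n div 2. int (n choose (2 * j)) * x\<^sub>1 ^ (n - 2 * j) * y\<^sub>1 ^ (2 * j) * d ^ j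
       else \<Sum>j = 0..(n - 1) div 2. int (n choose (2 * j)) * x\<^sub>1 ^ (n - 2 * j) * y\<^sub>1 ^ (2 * j) * d ^ j,
     if even n
       then \<Sum>j = 0..(n - 2) div 2. int (n choose (2 * j + 1)) * x\<^sub>1 ^ (n - 1 - 2 * j) * y\<^sub>1 ^ (2 * j + 1) * d ^ j
       else \<Sum>j = 0..(n - 1) div 2. int (n choose (2 * j + 1)) * x\<^sub>1 ^ (n - 1 - 2 * j) * y\<^sub>1 ^ (2 * j + 1) * d ^ j)"
proof -
  let ?f = "\<lambda>j. int (n choose (2 * j + 1)) * x\<^sub>1 ^ (n - 1 - 2 * j) * y\<^sub>1 ^ (2 * j + 1) * d ^ j"
  \<comment> \<open>For even \<open>n\<close> the stated sum omits the term
    \<open>j = n div 2\<close>, whose coefficient is \<open>n choose (n + 1) = 0\<close>.\<close>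
  have even_odd_sum: "(\<Sum>j = 0..(n - 2) div 2. ?f j) = (\<Sum>j = 0..n div 2. ?f j)" if "even n"
  proof (rule sum.mono_neutral_left)
    have "n < 2 * j + 1" if "j \<in> {0..n div 2} - {0..(n - 2) div 2}" for j
      using that \<open>even n\<close> by simp presburger
    then show "\<forall>j \<in> {0..n div 2} - {0..(n - 2) div 2}. ?f j = 0" by (simp add: binomial_eq_0)
  qed auto
  have "(n - 1) div 2 = n div 2" if "odd n" using that by (auto elim: oddE)
  then have "pell_power d (x\<^sub>1, y\<^sub>1) n =
    (if even n
       then \<Sum>j = 0..n div 2. int (n choose (2 * j)) * x\<^sub>1 ^ (n - 2 * j) * y\<^sub>1 ^ (2 * j) * d ^ j
       else \<Sum>j = 0..(n - 1) div 2. int (n choose (2 * j)) * x\<^sub>1 ^ (n - 2 * j) * y\<^sub>1 ^ (2 * j) * d ^ j,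
     if even n
       then \<Sum>j = 0..(n - 2) div 2. ?f j
       else \<Sum>j = 0..(n - 1) div 2. ?f j)"
    using even_odd_sum unfolding pell_power_eq_binomial_sums[OF \<open>d > 0\<close>] by (cases "even n") simp_all
  \<comment> \<open>The enumeration required by \<open>is_nth_solution\<close> is
    \<open>pell_power d (x\<^sub>1, y\<^sub>1)\<close> itself.\<close>
  then show ?thesis
    using lists_pell_solutions_power[OF \<open>d > 0\<close> \<open>is_fundamental_solution d (x\<^sub>1, y\<^sub>1)\<close>] \<open>n \<ge> 1\<close>
    unfolding is_nth_solution_def by blast
qed

end
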